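(* Let $Y$ be a real Banach space, $n$ a positive integer and $B\subset S_{Y^*}$ a $1$-norming subset. The following assertions are equivalent. 1) $Y$ has the AHSp-$\ell_\infty^n$. 2) For every $0<\varepsilon<1$ there is $0<\gamma<\varepsilon$ such that for every $(y_i)_{i\le n}\in M_Y^n$, if there exist a nonempty $A\subset\{1,\dots,n\}$ and $y^*\in B$ with $y^*(y_i)>1-\gamma$ for each $i\in A$, then there exists $(z_i)_{i\le n}\in M_Y^n$ with $\|z_i-y_i\|<\varepsilon$ for every $i\le n$ and $\bigl\|\sum_{i\in A}z_i\bigr\|=|A|$. 3) For every $0<\varepsilon<1$ there exists $0<\rho_n(\varepsilon)<\varepsilon$ such that for every $(y_i)_{i\le n}\in M_Y^n$, if there exist a positive integer $n_0\le n$ and $y^*\in B$ such that $y^*(y_i)>1-\rho_n(\varepsilon)$ for each $i\le n_0$, then there exists $(z_i)_{i\le n}\in M_Y^n$ satisfying $\|z_i-y_i\|<\varepsilon$ for each $i\le n$ and $\bigl\|\sum_{i=1}^{n_0}z_i\bigr\|=n_0$. 4) For every $0<\varepsilon<1$ there exists $0<\nu_n(\varepsilon)<\varepsilon$ such that for each $(y_i)_{i\le n}\in M_Y^n$ and each convex combination $\sum_{i=1}^n\alpha_iy_i$ satisfying $\bigl\|\sum_{i=1}^n\alpha_iy_i\bigr\|>1-\nu_n(\varepsilon)$, there exist a set $C\subset\{1,\dots,n\}$ and an element $(z_i)_{i\le n}\in M_Y^n$ such that (i) $\sum_{i\in C}\alpha_i>1-\varepsilon$, (ii) $\|z_i-y_i\|<\varepsilon$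 for each $i\le n$, and (iii) $\bigl\|\sum_{i\in C}z_i\bigr\|=|C|$. Moreover, if 1) holds with the function $\gamma_n$, then 4) holds with $\nu_n=\gamma_n^2$ (pointwise square). If 4) holds with the function $\nu_n$, then 1) holds with the function $\gamma_n(\varepsilon)=\nu_n\bigl(\frac{\varepsilon}{n}\bigr)$. If 3) holds with $\rho_n$, then 1) holds with the function $\gamma_n(\varepsilon)=\frac14\bigl(\rho_n\bigl(\frac{\varepsilon}{n}\bigr)\bigr)^2$.
   Context: All spaces are real. $S_{Y^*}$ and $B_{Y^*}$ are the unit sphere and closed unit ball of the dual $Y^*$. A subset $B\subset B_{Y^*}$ is $1$-norming if $\|y\|=\sup\{|y^*(y)|:y^*\in B\}$ for all $y\in Y$. $M_Y^n$ is the set of all $(y_i)_{i\le n}\in Y^n$ such that $\bigl\|\sum_{j=1}^k(-1)^{j+1}y_{i_j}\bigr\|\le 1$ for every odd $k\le n$ and all indices $1\le i_1<\dots<i_k\le n$. AHSp-$\ell_\infty^n$: $Y$ has the approximate hyperplane sum property for $\ell_\infty^n$ with a function $\gamma_n:(0,1)\to(0,1)$ if for every $0<\varepsilon<1$ one has $0<\gamma_n(\varepsilon)<\varepsilon$ and: for every $(y_i)_{i\le n}\in M_Y^n$, if there exist a nonempty $A\subset\{1,\dots,n\}$ and $y^*\in S_{Y^*}$ with $y^*(y_i)>1-\gamma_n(\varepsilon)$ for each $i\in A$, then there exists $(z_i)_{i\le n}\in M_Y^n$ with $\|z_i-y_i\|<\varepsilon$ for every $i\le n$ and $\bigl\|\sum_{i\in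 A}z_i\bigr\|=|A|$. $Y$ has the AHSp-$\ell_\infty^n$ if it has it with some function $\gamma_n$ ("1) holds with the function $\gamma_n$"). *)

theory Defs
  imports "HOL-Analysis.Analysis"
begin

text \<open>
  The space \<open>Y\<close> is a type of class \<open>banach\<close>, its dual is the type of bounded linear functionals
  \<open>'a \<Rightarrow>\<^sub>L real\<close> with the operator norm, and elements of \<open>Y\<close> to the power \<open>n\<close> are functions in
  \<open>{1..n} \<rightarrow>\<^sub>E UNIV\<close> (extensional outside \<open>{1..n}\<close>).
\<close>

text \<open>
  The supremum is taken in \<open>[0, \<infinity>]\<close>, where the supremum of the empty set is \<open>0\<close>; a supremum in
  \<open>real\<close> would be unspecified for the zero space, whose dual unit sphere is empty.
\<close>

definition one_norming :: "('a::real_normed_vector \<Rightarrow>\<^sub>L real) set \<Rightarrow> bool" where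
  "one_norming B \<longleftrightarrow>
     B \<subseteq> cball 0 1 \<and> (\<forall>y. ennreal (norm y) = (SUP f\<in>B. ennreal \<bar>blinfun_apply f y\<bar>))"

definition M_tuples :: "nat \<Rightarrow> (nat \<Rightarrow> 'a::real_normed_vector) set" where
  "M_tuples n = {y \<in> {1..n} \<rightarrow>\<^sub>E UNIV.
     \<forall>k i. odd k \<and> k \<le> n \<and> i \<in> {1..k} \<rightarrow> {1..n} \<and> strict_mono_on {1..k} i \<longrightarrow>
       norm (\<Sum>j=1..k. (-1) ^ (j + 1) *\<^sub>R y (i j)) \<le> 1}"

definition hyperplane_approx ::
    "nat \<Rightarrow> real \<Rightarrow> (nat \<Rightarrow> 'a::real_normed_vector) \<Rightarrow> nat set \<Rightarrow> bool" where
  "hyperplane_approx n \<epsilon> y A \<longleftrightarrow>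
     (\<exists>z\<in>M_tuples n. (\<forall>i\<in>{1..n}. norm (z i - y i) < \<epsilon>) \<and> norm (\<Sum>i\<in>A. z i) = real (card A))"

text \<open>
  \<open>D\<close> is the set from which the functional is taken: the whole dual unit sphere in the property
  itself, a norming subset \<open>B\<close> in its reformulations. The last argument of the \<open>_const\<close>
  predicates is the constant that belongs to \<open>\<epsilon>\<close>.
\<close>

definition AHSp_const ::
    "('a::real_normed_vector \<Rightarrow>\<^sub>L real) set \<Rightarrow> nat \<Rightarrow> real \<Rightarrow> real \<Rightarrow> bool" where
  "AHSp_const D n \<epsilon> \<gamma> \<longleftrightarrow> 0 < \<gamma> \<and> \<gamma> < \<epsilon> \<and>
     (\<forall>y\<in>M_tuples n. \<forall>A f. A \<noteq> {} \<and> A \<subseteq> {1..n} \<and> f \<in> D \<and>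
        (\<forall>i\<in>A. blinfun_apply f (y i) > 1 - \<gamma>) \<longrightarrow> hyperplane_approx n \<epsilon> y A)"

definition AHSp_initial_const ::
    "('a::real_normed_vector \<Rightarrow>\<^sub>L real) set \<Rightarrow> nat \<Rightarrow> real \<Rightarrow> real \<Rightarrow> bool" where
  "AHSp_initial_const D n \<epsilon> \<rho> \<longleftrightarrow> 0 < \<rho> \<and> \<rho> < \<epsilon> \<and>
     (\<forall>y\<in>M_tuples n. \<forall>n\<^sub>0 f. 0 < n\<^sub>0 \<and> n\<^sub>0 \<le> n \<and> f \<in> D \<and>
        (\<forall>i\<in>{1..n\<^sub>0}. blinfun_apply f (y i) > 1 - \<rho>) \<longrightarrow> hyperplane_approx n \<epsilon> y {1..n\<^sub>0})"

definition AHSp_convex_const ::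
    "'a::real_normed_vector itself \<Rightarrow> nat \<Rightarrow> real \<Rightarrow> real \<Rightarrow> bool" where
  "AHSp_convex_const Y n \<epsilon> \<nu> \<longleftrightarrow> 0 < \<nu> \<and> \<nu> < \<epsilon> \<and>
     (\<forall>y\<in>M_tuples n :: (nat \<Rightarrow> 'a) set. \<forall>\<alpha> :: nat \<Rightarrow> real.
        (\<forall>i\<in>{1..n}. 0 \<le> \<alpha> i) \<and> (\<Sum>i=1..n. \<alpha> i) = 1 \<and>
        norm (\<Sum>i=1..n. \<alpha> i *\<^sub>R y i) > 1 - \<nu> \<longrightarrow>
        (\<exists>C\<subseteq>{1..n}. (\<Sum>i\<in>C. \<alpha> i) > 1 - \<epsilon> \<and> hyperplane_approx n \<epsilon> y C))"

definition AHSp_linf_with :: "'a::real_normed_vector itself \<Rightarrow> nat \<Rightarrow> (real \<Rightarrow> real) \<Rightarrow> bool" where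
  "AHSp_linf_with Y n \<gamma> \<longleftrightarrow>
     (\<forall>\<epsilon>\<in>{0<..<1}. AHSp_const (sphere (0 :: 'a \<Rightarrow>\<^sub>L real) 1) n \<epsilon> (\<gamma> \<epsilon>))"

definition AHSp_linf :: "'a::real_normed_vector itself \<Rightarrow> nat \<Rightarrow> bool" where
  "AHSp_linf Y n \<longleftrightarrow> (\<exists>\<gamma>. AHSp_linf_with Y n \<gamma>)"

end

theory Submission imports Defs begin

text \<open>
  If \<open>f (y i)\<close> is close to \<open>1\<close> for all \<open>i \<in> A\<close>, then \<open>\<parallel>y a - y b + y c\<parallel> \<le> 1\<close> forces it to be
  close to \<open>1\<close> also at every \<open>b\<close> between two elements \<open>a < c\<close> of \<open>A\<close>; so \<open>A\<close> may be replaced by an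
  interval. The signed rotation \<open>(y 1, \<dots>, y n) \<mapsto> (y 2, \<dots>, y n, - y 1)\<close> is a bijection of the set
  \<open>M_tuples n\<close>, and it moves the interval to an initial segment. The functional
  is exchanged for one in \<open>B\<close> through the norm of the sum (up to a sign, which is harmless because
  \<open>M_tuples n\<close> is symmetric). The convex version 4) is the usual averaging argument, applied with
  uniform weights on \<open>A\<close> in the converse direction.
\<close>

section \<open>Alternating sums\<close>

text \<open>Lists of indices replace the index maps of \<open>M_tuples\<close>, so that shifting,
  prepending and appending indices become \<open>map\<close>, \<open>#\<close> and \<open>@\<close>.
  The nested subtraction produces the signs +, -, +, and so on.\<close>

fun alt_sum :: "(nat \<Rightarrow> 'a::ab_group_add) \<Rightarrow> nat list \<Rightarrow> 'a" where
  "alt_sum y [] = 0"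
| "alt_sum y (i # is) = y i - alt_sum y is"

lemma alt_sum_eq_sum:
  fixes y :: "nat \<Rightarrow> 'a::real_vector"
  shows "alt_sum y is = (\<Sum>j<length is. (-1) ^ j *\<^sub>R y (is ! j))"
  by (induction "is") (simp_all add: sum.lessThan_Suc_shift sum_negf del: sum.lessThan_Suc)

text \<open>A rotation carries an index from one end of the list to the other; at the far end the
  parity of the length decides the sign.\<close>

lemma alt_sum_snoc:
  fixes y :: "nat \<Rightarrow> 'a::real_vector"
  shows "alt_sum y (is @ [m]) = alt_sum y is + (-1) ^ length is *\<^sub>R y m"
  by (induction "is") simp_all

lemma alt_sum_cong:
  assumes "\<And>i. i \<in> set is \<Longrightarrow> x i = y (g i)"
  shows "alt_sum x is = alt_sum y (map g is)"
  using assms by (induction "is") auto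

lemma alt_sum_uminus: "alt_sum (\<lambda>i. - y i) is = - alt_sum y is"
  by (induction "is") simp_all

text \<open>A strictly increasing map on \<open>{1..k}\<close> amounts to a strictly sorted list of
  length \<open>k\<close>. The bound \<open>k \<le> n\<close> is implicit on the list side, since
  the entries are distinct elements of \<open>{1..n}\<close>.\<close>

lemma M_tuples_iff_alt_sum:
  "y \<in> M_tuples n \<longleftrightarrow> y \<in> extensional {1..n} \<and>
     (\<forall>is. sorted_wrt (<) is \<and> set is \<subseteq> {1..n} \<and> odd (length is) \<longrightarrow> norm (alt_sum y is) \<le> 1)"
  (is "?L \<longleftrightarrow> ?E \<and> ?R")
proof
  assume L: ?L
  then have E: ?E by (auto simp: M_tuples_def PiE_def)
  have ?R
  proof (intro allI impI)
    fix "is" :: "nat list"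
    assume a: "sorted_wrt (<) is \<and> set is \<subseteq> {1..n} \<and> odd (length is)"
    let ?k = "length is" and ?i = "\<lambda>j. is ! (j - 1)"
    have "card (set is) \<le> card {1..n}"
      using a by (intro card_mono) auto
    moreover have "card (set is) = ?k"
      using a strict_sorted_iff distinct_card by blast
    ultimately have k: "?k \<le> n" by simp
    have i: "?i \<in> {1..?k} \<rightarrow> {1..n}"
    proof
      fix j assume "j \<in> {1..?k}"
      then have "is ! (j - 1) \<in> set is" by (intro nth_mem) auto
      then show "is ! (j - 1) \<in> {1..n}" using a by blast
    qed
    have s: "strict_mono_on {1..?k} ?i"
    proof (rule strict_mono_onI)
      fix r s assume "r \<in> {1..?k}" "s \<in> {1..?k}" "r < s"
      then show "is ! (r - 1) < is ! (s - 1)"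
        using a by (intro sorted_wrt_nth_less[of "(<)"]) auto
    qed
    have "norm (\<Sum>j=1..?k. (-1) ^ (j + 1) *\<^sub>R y (?i j)) \<le> 1"
      using L k i s a unfolding M_tuples_def by blast
    \<comment> \<open>Counting starts at 1 on the left and at 0 in the list; the exponents
      \<open>j + 1\<close> and \<open>j - 1\<close> have the same parity.\<close>
    moreover have "(\<Sum>j=1..?k. (-1) ^ (j + 1) *\<^sub>R y (?i j)) = alt_sum y is"
      unfolding alt_sum_eq_sum
      by (rule sum.reindex_bij_witness[of _ Suc "\<lambda>j. j - 1"]) (auto simp: Suc_le_eq gr0_conv_Suc)
    ultimately show "norm (alt_sum y is) \<le> 1" by simp
  qed
  with E show "?E \<and> ?R" by simp
next
  assume ER: "?E \<and> ?R"
  show ?L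
    unfolding M_tuples_def
  proof (intro CollectI conjI allI impI)
    show "y \<in> {1..n} \<rightarrow>\<^sub>E UNIV" using ER by (auto simp: PiE_def)
    fix k i
    assume a: "odd k \<and> k \<le> n \<and> i \<in> {1..k} \<rightarrow> {1..n} \<and> strict_mono_on {1..k} i"
    let ?is = "map i [1..<Suc k]"
    have "sorted_wrt (<) ?is"
      unfolding sorted_wrt_map
      using a by (intro sorted_wrt_mono_rel[OF _ sorted_wrt_upt]) (auto simp: strict_mono_on_def)
    moreover have "set ?is \<subseteq> {1..n}" using a by auto
    moreover have "odd (length ?is)" using a by (simp del: upt_Suc)
    ultimately have "norm (alt_sum y ?is) \<le> 1" using ER by blast
    moreover have "(\<Sum>j=1..k. (-1) ^ (j + 1) *\<^sub>R y (i j)) = alt_sum y ?is"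
      unfolding alt_sum_eq_sum
      by (rule sum.reindex_bij_witness[of _ Suc "\<lambda>j. j - 1"]) (auto simp: Suc_le_eq gr0_conv_Suc simp del: upt_Suc)
    ultimately show "norm (\<Sum>j=1..k. (-1) ^ (j + 1) *\<^sub>R y (i j)) \<le> 1" by simp
  qed
qed

lemma M_tuples_alt_sum:
  assumes "y \<in> M_tuples n" "sorted_wrt (<) is" "set is \<subseteq> {1..n}" "odd (length is)"
  shows "norm (alt_sum y is) \<le> 1"
  using assms by (simp add: M_tuples_iff_alt_sum)

lemma M_tuples_norm_le:
  assumes "y \<in> M_tuples n" "i \<in> {1..n}"
  shows "norm (y i) \<le> 1"
  using M_tuples_alt_sum[OF assms(1), of "[i]"] assms(2) by simp

section \<open>Symmetries of the set of tuples\<close>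

lemma M_tuples_uminus:
  assumes "y \<in> M_tuples n"
  shows "(\<lambda>i\<in>{1..n}. - y i) \<in> M_tuples n"
  unfolding M_tuples_iff_alt_sum
proof (intro conjI allI impI)
  fix "is" :: "nat list"
  assume a: "sorted_wrt (<) is \<and> set is \<subseteq> {1..n} \<and> odd (length is)"
  have "alt_sum (\<lambda>i\<in>{1..n}. - y i) is = alt_sum (\<lambda>i. - y i) (map id is)"
    using a by (intro alt_sum_cong) auto
  then show "norm (alt_sum (\<lambda>i\<in>{1..n}. - y i) is) \<le> 1"
    using M_tuples_alt_sum[OF assms, of "is"] a by (simp add: alt_sum_uminus)
qed simp

text \<open>Moving an end term of an alternating sum of odd length to the other end reverses the
  signs of all remaining terms. Negating the moved term as well leaves only a global sign, which the
  norm does not see.\<close>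

definition rotate_left :: "nat \<Rightarrow> (nat \<Rightarrow> 'a::ab_group_add) \<Rightarrow> nat \<Rightarrow> 'a" where
  "rotate_left n y = (\<lambda>i\<in>{1..n}. if i < n then y (Suc i) else - y 1)"

definition rotate_right :: "nat \<Rightarrow> (nat \<Rightarrow> 'a::ab_group_add) \<Rightarrow> nat \<Rightarrow> 'a" where
  "rotate_right n y = (\<lambda>i\<in>{1..n}. if 1 < i then y (i - 1) else - y n)"

lemma M_tuples_rotate_left:
  assumes "y \<in> M_tuples n"
  shows "rotate_left n y \<in> M_tuples n"
  unfolding M_tuples_iff_alt_sum
proof (intro conjI allI impI)
  show "rotate_left n y \<in> extensional {1..n}" by (simp add: rotate_left_def)
  fix "is" :: "nat list"
  assume a: "sorted_wrt (<) is \<and> set is \<subseteq> {1..n} \<and> odd (length is)"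
  have shift: "alt_sum (rotate_left n y) js = alt_sum y (map Suc js)"
    if "set js \<subseteq> {1..<n}" for js
    using that by (intro alt_sum_cong) (auto simp: rotate_left_def)
  show "norm (alt_sum (rotate_left n y) is) \<le> 1"
  proof (cases "n \<in> set is")
    case False
    have sub: "set is \<subseteq> {1..<n}"
    proof
      fix i assume "i \<in> set is"
      then have "i \<in> {1..n}" "i \<noteq> n" using a False by (blast, blast)
      then show "i \<in> {1..<n}" by simp
    qed
    have "norm (alt_sum y (map Suc is)) \<le> 1"
      using a sub by (intro M_tuples_alt_sum[OF assms]) (auto simp: sorted_wrt_map)
    then show ?thesis using shift[OF sub] by simp
  next
    case True
    obtain js m where jm: "is = js @ [m]"
      using True by (cases "is" rule: rev_cases) auto
    have lt: "\<forall>j\<in>set js. j < m" using a jm by (auto simp: sorted_wrt_append)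
    \<comment> \<open>The list increases and its entries are at most \<open>n\<close>, so
      \<open>n\<close> can only be the last one.\<close>
    have m: "m = n" using True a jm lt by fastforce
    have sub: "set js \<subseteq> {1..<n}" using a jm lt m by auto
    have n: "1 \<le> n" using a jm m by auto
    have "norm (alt_sum y (1 # map Suc js)) \<le> 1"
      using a jm sub n
      by (intro M_tuples_alt_sum[OF assms]) (auto simp: sorted_wrt_map sorted_wrt_append)
    \<comment> \<open>As \<open>js\<close> has even length, the last term enters with sign + and
      equals \<open>- y 1\<close>; taking out the global sign puts \<open>1\<close> in front of the
      shifted indices.\<close>
    moreover have "alt_sum (rotate_left n y) is = - alt_sum y (1 # map Suc js)"
      using shift[OF sub] a n unfolding jm m alt_sum_snoc by (simp add: rotate_left_def)
    ultimately show ?thesis by (metis norm_minus_cancel)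
  qed
qed

lemma M_tuples_rotate_right:
  assumes "y \<in> M_tuples n"
  shows "rotate_right n y \<in> M_tuples n"
  unfolding M_tuples_iff_alt_sum
proof (intro conjI allI impI)
  show "rotate_right n y \<in> extensional {1..n}" by (simp add: rotate_right_def)
  fix "is" :: "nat list"
  assume a: "sorted_wrt (<) is \<and> set is \<subseteq> {1..n} \<and> odd (length is)"
  have shift: "alt_sum (rotate_right n y) js = alt_sum y (map (\<lambda>i. i - 1) js)"
    if "set js \<subseteq> {1<..n}" for js
    using that by (intro alt_sum_cong) (auto simp: rotate_right_def)
  have range: "(\<lambda>i. i - 1) ` set js \<subseteq> {1..<n}" if "set js \<subseteq> {1<..n}" for js
    using that by fastforce
  \<comment> \<open>Truncated subtraction stays strictly increasing because all entries are
    positive.\<close>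
  have sorted: "sorted_wrt (<) (map (\<lambda>i. i - 1) js)"
    if "set js \<subseteq> {1<..n}" "sorted_wrt (<) js" for js
    unfolding sorted_wrt_map
    using that by (intro sorted_wrt_mono_rel[OF _ that(2)]) fastforce
  obtain i js where ij: "is = i # js"
    using a by (cases "is") auto
  have lt: "\<forall>j\<in>set js. i < j" using a ij by auto
  show "norm (alt_sum (rotate_right n y) is) \<le> 1"
  proof (cases "i = 1")
    case False
    then have sub: "set is \<subseteq> {1<..n}" using a lt ij by fastforce
    have "norm (alt_sum y (map (\<lambda>i. i - 1) is)) \<le> 1"
      using a range[OF sub] sorted[OF sub] by (intro M_tuples_alt_sum[OF assms]) fastforce+
    then show ?thesis using shift[OF sub] by simp
  next
    case True
    then have sub: "set js \<subseteq> {1<..n}" using a lt ij by auto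
    have n: "1 \<le> n" using a ij True by auto
    have "norm (alt_sum y (map (\<lambda>i. i - 1) js @ [n])) \<le> 1"
      using a ij n range[OF sub] sorted[OF sub]
      by (intro M_tuples_alt_sum[OF assms]) (fastforce simp: sorted_wrt_append)+
    \<comment> \<open>The head contributes \<open>- y n\<close>; appended after the evenly many
      shifted indices, \<open>y n\<close> has sign +, so the two sums are opposite.\<close>
    moreover have "alt_sum (rotate_right n y) is = - alt_sum y (map (\<lambda>i. i - 1) js @ [n])"
      using shift[OF sub] a ij True n unfolding alt_sum_snoc by (simp add: rotate_right_def)
    ultimately show ?thesis by (metis norm_minus_cancel)
  qed
qed

text \<open>The bound \<open>q < n\<close> keeps the interval away from position \<open>n\<close>,
  where the sign changes.\<close>

lemma sum_rotate_left:
  assumes "1 \<le> p" "q < n"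
  shows "(\<Sum>i=p..q. rotate_left n y i) = (\<Sum>i=Suc p..Suc q. y i)"
  unfolding sum.shift_bounds_cl_Suc_ivl
  using assms by (intro sum.cong) (auto simp: rotate_left_def)

text \<open>Here the sign changes at position 1, and the shifted interval starts at 2 or
  later.\<close>

lemma sum_rotate_right:
  assumes "1 \<le> p" "q < n"
  shows "(\<Sum>i=Suc p..Suc q. rotate_right n y i) = (\<Sum>i=p..q. y i)"
  unfolding sum.shift_bounds_cl_Suc_ivl
  using assms by (intro sum.cong) (auto simp: rotate_right_def)

section \<open>Transfer of approximations to other tuples and index sets\<close>

lemma hyperplane_approx_uminus:
  assumes "hyperplane_approx n \<epsilon> (\<lambda>i\<in>{1..n}. - y i) A" "A \<subseteq> {1..n}"
  shows "hyperplane_approx n \<epsilon> y A"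
proof -
  obtain z where z: "z \<in> M_tuples n"
    "\<And>i. i \<in> {1..n} \<Longrightarrow> norm (z i - (\<lambda>i\<in>{1..n}. - y i) i) < \<epsilon>"
    "norm (\<Sum>i\<in>A. z i) = real (card A)"
    using assms unfolding hyperplane_approx_def by blast
  let ?z = "\<lambda>i\<in>{1..n}. - z i"
  have "norm (?z i - y i) < \<epsilon>" if "i \<in> {1..n}" for i
  proof -
    have "?z i - y i = - (z i - (\<lambda>i\<in>{1..n}. - y i) i)" using that by simp
    then show ?thesis using z(2)[OF that] by (metis norm_minus_cancel)
  qed
  moreover have "(\<Sum>i\<in>A. ?z i) = - (\<Sum>i\<in>A. z i)"
    unfolding sum_negf[symmetric] using assms(2) by (intro sum.cong) auto
  ultimately show ?thesis
    using z(3) M_tuples_uminus[OF z(1)] unfolding hyperplane_approx_def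
    by (metis norm_minus_cancel)
qed

text \<open>Rotating the approximating tuple back by \<open>rotate_right\<close> keeps it in
  \<open>M_tuples n\<close> and permutes the errors up to sign.\<close>

lemma hyperplane_approx_rotate:
  assumes "hyperplane_approx n \<epsilon> (rotate_left n y) {p..q}" "1 \<le> p" "q < n"
  shows "hyperplane_approx n \<epsilon> y {Suc p..Suc q}"
proof -
  obtain z where z: "z \<in> M_tuples n"
    "\<And>i. i \<in> {1..n} \<Longrightarrow> norm (z i - rotate_left n y i) < \<epsilon>"
    "norm (\<Sum>i=p..q. z i) = real (card {p..q})"
    using assms unfolding hyperplane_approx_def by blast
  have "norm (rotate_right n z i - y i) < \<epsilon>" if i: "i \<in> {1..n}" for i
  proof (cases "1 < i")
    case True
    then have "rotate_left n y (i - 1) = y i" "rotate_right n z i = z (i - 1)"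
      using i by (auto simp: rotate_right_def rotate_left_def)
    then show ?thesis
      using z(2)[of "i - 1"] i True by fastforce
  next
    case False
    then have "i = 1" using i by simp
    \<comment> \<open>Both tuples wrap around here, so the error at position 1 is the negated error
      at position \<open>n\<close>.\<close>
    then have "rotate_right n z i - y i = - (z n - rotate_left n y n)"
      using i by (simp add: rotate_right_def rotate_left_def)
    then show ?thesis using z(2)[of n] i by (metis norm_minus_cancel atLeastAtMost_iff le_trans order_refl)
  qed
  then show ?thesis
    using z(3) M_tuples_rotate_right[OF z(1)] sum_rotate_right[OF assms(2,3), of z]
    unfolding hyperplane_approx_def by (metis card_atLeastAtMost diff_Suc_Suc)
qed

text \<open>All \<open>z i\<close> have norm at most 1, so a sum over \<open>C\<close> of norm
  \<open>card C\<close> leaves no slack in the triangle inequality, and the sum over any subset has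
  maximal norm as well.\<close>

lemma hyperplane_approx_mono:
  assumes "hyperplane_approx n \<delta> y C" "A \<subseteq> C" "C \<subseteq> {1..n}" "\<delta> \<le> \<epsilon>"
  shows "hyperplane_approx n \<epsilon> y A"
proof -
  obtain z where z: "z \<in> M_tuples n" "\<And>i. i \<in> {1..n} \<Longrightarrow> norm (z i - y i) < \<delta>"
    "norm (\<Sum>i\<in>C. z i) = real (card C)"
    using assms unfolding hyperplane_approx_def by blast
  have fin: "finite C" using assms(3) finite_subset by blast
  have bound: "norm (\<Sum>i\<in>D. z i) \<le> real (card D)" if "D \<subseteq> C" for D
    using sum_norm_le[of D z "\<lambda>_. 1"] M_tuples_norm_le[OF z(1)] assms(3) that by fastforce
  have "(\<Sum>i\<in>C. z i) = (\<Sum>i\<in>A. z i) + (\<Sum>i\<in>C - A. z i)"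
    using sum.subset_diff[OF assms(2) fin] by (metis add.commute)
  then have "real (card C) \<le> norm (\<Sum>i\<in>A. z i) + norm (\<Sum>i\<in>C - A. z i)"
    using z(3) norm_triangle_ineq by metis
  also have "\<dots> \<le> norm (\<Sum>i\<in>A. z i) + real (card (C - A))"
    using bound[of "C - A"] by simp
  also have "real (card (C - A)) = real (card C) - real (card A)"
    using card_mono[OF fin assms(2)] card_Diff_subset[OF finite_subset[OF assms(2) fin] assms(2)]
    by simp
  finally have "norm (\<Sum>i\<in>A. z i) = real (card A)"
    using bound[OF assms(2)] by simp
  moreover have "\<forall>i\<in>{1..n}. norm (z i - y i) < \<epsilon>"
    using z(2) assms(4) by fastforce
  ultimately show ?thesis
    using z(1) unfolding hyperplane_approx_def by blast
qed

section \<open>Functionals and tuples\<close>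

text \<open>This brings the supremum in \<open>ennreal\<close> back to the reals;
  \<open>0 \<le> c\<close> guards against the truncation of negative numbers to 0.\<close>

lemma one_norming_functional:
  assumes "one_norming B" "c < norm v" "0 \<le> c"
  obtains f where "f \<in> B" "c < \<bar>blinfun_apply f v\<bar>"
proof -
  have "ennreal c < (SUP f\<in>B. ennreal \<bar>blinfun_apply f v\<bar>)"
    using assms unfolding one_norming_def by (metis ennreal_lessI le_less_trans)
  then show thesis
    using that assms(3) by (auto simp: less_SUP_iff ennreal_less_iff)
qed

lemma blinfun_apply_le_norm:
  fixes f :: "'a::real_normed_vector \<Rightarrow>\<^sub>L real"
  assumes "norm f \<le> 1"
  shows "\<bar>blinfun_apply f v\<bar> \<le> norm v"
  using norm_blinfun[of f v] mult_right_mono[OF assms norm_ge_zero, of v] by simp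

lemma M_tuples_functional_le_1:
  fixes f :: "'a::real_normed_vector \<Rightarrow>\<^sub>L real"
  assumes "y \<in> M_tuples n" "i \<in> {1..n}" "norm f \<le> 1"
  shows "\<bar>blinfun_apply f (y i)\<bar> \<le> 1"
  using blinfun_apply_le_norm[OF assms(3), of "y i"] M_tuples_norm_le[OF assms(1,2)] by linarith

text \<open>The other \<open>card A - 1\<close> values are at most 1 each, so the whole deficit
  \<open>\<rho>\<close> is available to a single index.\<close>

lemma functional_gt_of_sum_gt:
  fixes f :: "'a::real_normed_vector \<Rightarrow>\<^sub>L real"
  assumes "y \<in> M_tuples n" "A \<subseteq> {1..n}" "norm f \<le> 1"
    and "blinfun_apply f (\<Sum>i\<in>A. y i) > real (card A) - \<rho>" "i \<in> A"
  shows "blinfun_apply f (y i) > 1 - \<rho>"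
proof -
  have fin: "finite A" using assms(2) finite_subset by blast
  have "blinfun_apply f (y j) \<le> 1" if "j \<in> A" for j
    using M_tuples_functional_le_1[OF assms(1) _ assms(3), of j] assms(2) that by fastforce
  then have "(\<Sum>j\<in>A - {i}. blinfun_apply f (y j)) \<le> real (card (A - {i})) * 1"
    by (intro sum_bounded_above) auto
  moreover have "real (card (A - {i})) = real (card A) - 1"
    using fin assms(5) by (metis card_Diff_singleton card_gt_0_iff empty_iff of_nat_1 of_nat_diff
        Suc_leI One_nat_def)
  moreover have "blinfun_apply f (\<Sum>i\<in>A. y i) = blinfun_apply f (y i) + (\<Sum>j\<in>A - {i}. blinfun_apply f (y j))"
    using fin assms(5) by (simp add: sum.remove blinfun.add_right blinfun.sum_right)
  ultimately show ?thesis using assms(4) by linarith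
qed

text \<open>Applying \<open>f\<close> to the three-term alternating sum gives
  \<open>f (y b) \<ge> f (y a) + f (y c) - 1\<close>; the deficits of both endpoints add up, hence
  the factor 2.\<close>

lemma functional_gt_between:
  fixes f :: "'a::real_normed_vector \<Rightarrow>\<^sub>L real"
  assumes y: "y \<in> M_tuples n" and f: "norm f \<le> 1" and \<gamma>: "0 < \<gamma>"
    and sub: "{a, c} \<subseteq> {1..n}" and b: "b \<in> {a..c}"
    and fa: "blinfun_apply f (y a) > 1 - \<gamma>" and fc: "blinfun_apply f (y c) > 1 - \<gamma>"
  shows "blinfun_apply f (y b) > 1 - 2 * \<gamma>"
proof (cases "b = a \<or> b = c")
  case True
  then show ?thesis using fa fc \<gamma> by auto
next
  case False
  then have "norm (alt_sum y [a, b, c]) \<le> 1"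
    using sub b by (intro M_tuples_alt_sum[OF y]) auto
  then have "\<bar>blinfun_apply f (alt_sum y [a, b, c])\<bar> \<le> 1"
    using blinfun_apply_le_norm[OF f, of "alt_sum y [a, b, c]"] by linarith
  then show ?thesis using fa fc by (simp add: blinfun.diff_right)
qed

section \<open>The implications\<close>

text \<open>A condition on the norm of the sum does not mention a functional, so one can be chosen
  in \<open>B\<close> afterwards; a nearly maximal sum then makes every single value nearly
  maximal.\<close>

lemma AHSp_initial_const_initial:
  fixes B :: "('a::real_normed_vector \<Rightarrow>\<^sub>L real) set" and y :: "nat \<Rightarrow> 'a"
  assumes "AHSp_initial_const B n \<epsilon> \<rho>" "one_norming B" "\<rho> \<le> 1" "y \<in> M_tuples n"
    and "1 \<le> q" "q \<le> n" "norm (\<Sum>i=1..q. y i) > real q - \<rho>"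
  shows "hyperplane_approx n \<epsilon> y {1..q}"
proof -
  have apply_const: "hyperplane_approx n \<epsilon> x {1..q}"
    if "x \<in> M_tuples n" "f \<in> B" "blinfun_apply f (\<Sum>i=1..q. x i) > real q - \<rho>" for x f
  proof -
    have "norm f \<le> 1" using that(2) assms(2) by (auto simp: one_norming_def)
    then have "\<forall>i\<in>{1..q}. blinfun_apply f (x i) > 1 - \<rho>"
      using functional_gt_of_sum_gt[OF that(1), of "{1..q}" f \<rho>] that(3) assms(6) by simp
    then show ?thesis
      using assms(1,5,6) that(1,2) unfolding AHSp_initial_const_def by (metis less_le_trans zero_less_one)
  qed
  have "0 \<le> real q - \<rho>" using assms(3,5) by simp
  then obtain f where f: "f \<in> B" "real q - \<rho> < \<bar>blinfun_apply f (\<Sum>i=1..q. y i)\<bar>"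
    using one_norming_functional[OF assms(2,7)] by blast
  show ?thesis
  proof (cases "blinfun_apply f (\<Sum>i=1..q. y i) \<ge> 0")
    case True
    then show ?thesis using apply_const[OF assms(4) f(1)] f(2) by simp
  next
    case False
    \<comment> \<open>\<open>B\<close> is not assumed symmetric, so the sign is moved from the
      functional to the tuple.\<close>
    let ?x = "\<lambda>i\<in>{1..n}. - y i"
    have "(\<Sum>i=1..q. ?x i) = - (\<Sum>i=1..q. y i)"
      unfolding sum_negf[symmetric] using assms(6) by (intro sum.cong) auto
    then have "hyperplane_approx n \<epsilon> ?x {1..q}"
      using apply_const[OF M_tuples_uminus[OF assms(4)] f(1)] f(2) False
      by (simp add: blinfun.minus_right)
    then show ?thesis by (rule hyperplane_approx_uminus) (use assms(6) in auto)
  qed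
qed

text \<open>Induction on \<open>p\<close>: each signed rotation moves the interval down by one place
  until it starts at 1. With endpoints written as successors, \<open>p = 0\<close> is the initial
  segment, and \<open>card {p..q}\<close> is the length of the interval.\<close>

lemma AHSp_initial_const_interval:
  fixes B :: "('a::real_normed_vector \<Rightarrow>\<^sub>L real) set" and y :: "nat \<Rightarrow> 'a"
  assumes "AHSp_initial_const B n \<epsilon> \<rho>" "one_norming B" "\<rho> \<le> 1" "y \<in> M_tuples n"
    and "p \<le> q" "q < n" "norm (\<Sum>i=Suc p..Suc q. y i) > real (card {p..q}) - \<rho>"
  shows "hyperplane_approx n \<epsilon> y {Suc p..Suc q}"
  using assms(4-7)
proof (induction p arbitrary: q y)
  case 0
  then show ?case
    using AHSp_initial_const_initial[OF assms(1-3), of y "Suc q"] by simp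
next
  case (Suc p)
  obtain r where r: "q = Suc r" using Suc.prems(2) by (cases q) auto
  have "hyperplane_approx n \<epsilon> (rotate_left n y) {Suc p..Suc r}"
  proof (rule Suc.IH)
    show "real (card {p..r}) - \<rho> < norm (\<Sum>i=Suc p..Suc r. rotate_left n y i)"
      using Suc.prems sum_rotate_left[of "Suc p" "Suc r" n y] r by simp
  qed (use Suc.prems r M_tuples_rotate_left in auto)
  then show ?case
    using hyperplane_approx_rotate[of n \<epsilon> y "Suc p" "Suc r"] Suc.prems r by simp
qed

text \<open>The deficit \<open>\<rho>\<^sup>2 / 4\<close> on \<open>A\<close> at most doubles on the
  interval spanned by \<open>A\<close>, so the sum over that interval loses at most
  \<open>n * \<rho>\<^sup>2 / 2\<close>. The scale \<open>\<epsilon> / n\<close> forces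
  \<open>n * \<rho> < 1\<close>, which puts this loss below \<open>\<rho>\<close>.\<close>

lemma AHSp_const_of_initial_const:
  fixes B :: "('a::real_normed_vector \<Rightarrow>\<^sub>L real) set"
  assumes "0 < n" "one_norming B" "0 < \<epsilon>" "\<epsilon> < 1" "AHSp_initial_const B n (\<epsilon> / real n) \<rho>"
  shows "AHSp_const (sphere (0 :: 'a \<Rightarrow>\<^sub>L real) 1) n \<epsilon> (1 / 4 * \<rho>\<^sup>2)"
proof -
  have \<rho>: "0 < \<rho>" "\<rho> < \<epsilon> / real n"
    using assms(5) unfolding AHSp_initial_const_def by auto
  have le: "\<epsilon> / real n \<le> \<epsilon>"
    using assms(1,3) by (simp add: divide_le_eq mult_le_cancel_left1)
  have n\<rho>: "real n * \<rho> < 1"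
    using \<rho>(2) assms(1,4) by (simp add: pos_less_divide_eq mult.commute)
  have "\<rho>\<^sup>2 \<le> \<rho>"
    using \<rho> le assms(4) by (simp add: power2_eq_square mult_le_cancel_left1)
  then have small: "1 / 4 * \<rho>\<^sup>2 < \<epsilon>" "0 < 1 / 4 * \<rho>\<^sup>2"
    using \<rho> le by (simp, simp)
  have "hyperplane_approx n \<epsilon> y A"
    if y: "y \<in> M_tuples n" and A: "A \<noteq> {}" "A \<subseteq> {1..n}" and f: "norm f = 1"
      and fA: "\<forall>i\<in>A. blinfun_apply f (y i) > 1 - 1 / 4 * \<rho>\<^sup>2" for y A and f :: "'a \<Rightarrow>\<^sub>L real"
  proof -
    have fin: "finite A" using A finite_subset by blast
    have mem: "Min A \<in> A" "Max A \<in> A" using fin A by auto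
    then have "Min A \<in> {1..n}" "Max A \<in> {1..n}" "Min A \<le> Max A"
      using A fin by (blast, blast, simp)
    then obtain p q where pq: "Min A = Suc p" "Max A = Suc q" "p \<le> q" "q < n"
      by (metis Suc_le_eq Suc_le_mono atLeastAtMost_iff not0_implies_Suc not_one_le_zero)
    let ?I = "{Suc p..Suc q}"
    have AI: "A \<subseteq> ?I"
    proof
      fix i assume "i \<in> A"
      then show "i \<in> ?I" using Min_le[OF fin, of i] Max_ge[OF fin, of i] pq by simp
    qed
    \<comment> \<open>Both endpoints of the interval lie in \<open>A\<close>, so every index of the
      interval is between two elements of \<open>A\<close>.\<close>
    have fI: "blinfun_apply f (y i) \<ge> 1 - \<rho>\<^sup>2 / 2" if "i \<in> ?I" for i
      using functional_gt_between[OF y _ small(2), of f "Suc p" "Suc q" i] f fA mem pq that A(2)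
      by fastforce
    have "real (card ?I) * (1 - \<rho>\<^sup>2 / 2) \<le> (\<Sum>i\<in>?I. blinfun_apply f (y i))"
      by (rule sum_bounded_below) (rule fI)
    also have "\<dots> \<le> norm (\<Sum>i\<in>?I. y i)"
      using blinfun_apply_le_norm[of f "\<Sum>i\<in>?I. y i"] f
      by (simp add: blinfun.sum_right del: sum.cl_ivl_Suc)
    finally have sum_ge: "real (card ?I) - real (card ?I) * \<rho>\<^sup>2 / 2 \<le> norm (\<Sum>i\<in>?I. y i)"
      by (simp add: algebra_simps)
    have "real (card ?I) * \<rho>\<^sup>2 \<le> real n * \<rho>\<^sup>2"
      using pq by (intro mult_right_mono) auto
    also have "\<dots> < 1 * \<rho>"
      using mult_strict_right_mono[OF n\<rho> \<rho>(1)] by (simp add: power2_eq_square)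
    finally have "norm (\<Sum>i\<in>?I. y i) > real (card {p..q}) - \<rho>"
      using sum_ge \<rho>(1) by simp
    then have "hyperplane_approx n (\<epsilon> / real n) y ?I"
      using AHSp_initial_const_interval[OF assms(5,2) _ y pq(3,4)] \<rho> le assms(4) by simp
    then show ?thesis
      by (rule hyperplane_approx_mono) (use AI pq le in auto)
  qed
  then show ?thesis
    using small unfolding AHSp_const_def by (auto simp del: One_nat_def)
qed

section \<open>Convex combinations\<close>

text \<open>The norming set supplies a unit functional that nearly attains the norm of the
  combination. A Markov-type estimate then bounds the weight of the indices with small value; the
  square lets the deficit be divided by \<open>\<gamma>\<close> once.\<close>

lemma AHSp_convex_const_of_const:
  fixes B :: "('a::real_normed_vector \<Rightarrow>\<^sub>L real) set"
  assumes "B \<subseteq> sphere 0 1" "one_norming B" "\<epsilon> < 1"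
    and const: "AHSp_const (sphere (0 :: 'a \<Rightarrow>\<^sub>L real) 1) n \<epsilon> \<gamma>"
  shows "AHSp_convex_const TYPE('a) n \<epsilon> (\<gamma>\<^sup>2)"
proof -
  have \<gamma>: "0 < \<gamma>" "\<gamma> < \<epsilon>"
    using const unfolding AHSp_const_def by auto
  have sq: "\<gamma>\<^sup>2 \<le> \<gamma>"
    using \<gamma> assms(3) by (simp add: power2_eq_square mult_le_cancel_left1)
  have "\<exists>C\<subseteq>{1..n}. (\<Sum>i\<in>C. \<alpha> i) > 1 - \<epsilon> \<and> hyperplane_approx n \<epsilon> y C"
    if y: "y \<in> M_tuples n" and \<alpha>: "\<forall>i\<in>{1..n}. 0 \<le> \<alpha> i" "(\<Sum>i=1..n. \<alpha> i) = 1"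
      and big: "norm (\<Sum>i=1..n. \<alpha> i *\<^sub>R y i) > 1 - \<gamma>\<^sup>2" for y :: "nat \<Rightarrow> 'a" and \<alpha> :: "nat \<Rightarrow> real"
  proof -
    let ?v = "\<Sum>i=1..n. \<alpha> i *\<^sub>R y i"
    obtain g where g: "g \<in> B" "1 - \<gamma>\<^sup>2 < \<bar>blinfun_apply g ?v\<bar>"
      using one_norming_functional[OF assms(2) big] sq \<gamma> assms(3) by auto
    \<comment> \<open>The negated functional may leave \<open>B\<close>, but it stays in the unit
      sphere, where the constant \<open>\<gamma>\<close> applies.\<close>
    define f where "f = (if blinfun_apply g ?v \<ge> 0 then g else - g)"
    have f: "norm f = 1" "1 - \<gamma>\<^sup>2 < blinfun_apply f ?v"
      using g assms(1) unfolding f_def by (auto simp: blinfun.minus_left)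
    define C where "C = {i\<in>{1..n}. blinfun_apply f (y i) > 1 - \<gamma>}"
    have C: "C \<subseteq> {1..n}" unfolding C_def by auto
    have split: "(\<Sum>i=1..n. h i) = (\<Sum>i\<in>C. h i) + (\<Sum>i\<in>{1..n} - C. h i)" for h :: "nat \<Rightarrow> real"
      using sum.subset_diff[OF C, of h] by simp
    \<comment> \<open>The values are at most 1 on \<open>C\<close> and at most
      \<open>1 - \<gamma>\<close> off \<open>C\<close>. Hence the weight \<open>w\<close> off
      \<open>C\<close> satisfies \<open>\<gamma> * w < \<gamma>\<^sup>2\<close>, so
      \<open>w < \<gamma> < \<epsilon>\<close>.\<close>
    have "(\<Sum>i\<in>C. \<alpha> i * blinfun_apply f (y i)) \<le> (\<Sum>i\<in>C. \<alpha> i * 1)"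
    proof (intro sum_mono mult_left_mono)
      fix i assume "i \<in> C"
      then have i: "i \<in> {1..n}" using C by blast
      then show "0 \<le> \<alpha> i" using \<alpha> by blast
      show "blinfun_apply f (y i) \<le> 1"
        using M_tuples_functional_le_1[OF y i, of f] f(1) by simp
    qed
    moreover have "(\<Sum>i\<in>{1..n} - C. \<alpha> i * blinfun_apply f (y i)) \<le> (\<Sum>i\<in>{1..n} - C. \<alpha> i * (1 - \<gamma>))"
      using \<alpha> by (intro sum_mono mult_left_mono) (auto simp: C_def)
    moreover have "blinfun_apply f ?v = (\<Sum>i=1..n. \<alpha> i * blinfun_apply f (y i))"
      by (simp add: blinfun.sum_right blinfun.scaleR_right)
    ultimately have "1 - \<gamma>\<^sup>2 < (\<Sum>i\<in>C. \<alpha> i) + (\<Sum>i\<in>{1..n} - C. \<alpha> i) * (1 - \<gamma>)"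
      using f(2) split[of "\<lambda>i. \<alpha> i * blinfun_apply f (y i)"] by (simp add: sum_distrib_right)
    also have "(\<Sum>i\<in>{1..n} - C. \<alpha> i) = 1 - (\<Sum>i\<in>C. \<alpha> i)"
      using split[of \<alpha>] \<alpha>(2) by simp
    also have "(\<Sum>i\<in>C. \<alpha> i) + (1 - (\<Sum>i\<in>C. \<alpha> i)) * (1 - \<gamma>) = 1 - \<gamma> * (1 - (\<Sum>i\<in>C. \<alpha> i))"
      by (simp add: algebra_simps)
    finally have "\<gamma> * (1 - (\<Sum>i\<in>C. \<alpha> i)) < \<gamma> * \<gamma>"
      by (simp add: power2_eq_square)
    then have weight: "(\<Sum>i\<in>C. \<alpha> i) > 1 - \<epsilon>"
      using \<gamma> by simp
    have "C \<noteq> {}" using weight assms(3) by auto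
    moreover have "f \<in> sphere 0 1" "\<forall>i\<in>C. blinfun_apply f (y i) > 1 - \<gamma>"
      using f(1) by (auto simp: C_def)
    ultimately have "hyperplane_approx n \<epsilon> y C"
      using const y C unfolding AHSp_const_def by blast
    then show ?thesis using weight C by blast
  qed
  then show ?thesis
    using \<gamma> sq unfolding AHSp_convex_const_def by auto
qed

text \<open>With uniform weights on \<open>A\<close>, each index of \<open>A\<close> weighs at least
  \<open>1 / n\<close>, too much to be dropped when the total loss is below
  \<open>\<epsilon> / n\<close>. This dictates the scale \<open>\<epsilon> / n\<close>.\<close>

lemma AHSp_const_of_convex_const:
  assumes "0 < n" "0 < \<epsilon>" "\<epsilon> < 1" "AHSp_convex_const TYPE('a::real_normed_vector) n (\<epsilon> / real n) \<nu>"
  shows "AHSp_const (sphere (0 :: 'a \<Rightarrow>\<^sub>L real) 1) n \<epsilon> \<nu>"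
proof -
  have le: "\<epsilon> / real n \<le> \<epsilon>"
    using assms(1,2) by (simp add: divide_le_eq mult_le_cancel_left1)
  have "hyperplane_approx n \<epsilon> y A"
    if y: "y \<in> M_tuples n" and A: "A \<noteq> {}" "A \<subseteq> {1..n}" and f: "norm f = 1"
      and fA: "\<forall>i\<in>A. blinfun_apply f (y i) > 1 - \<nu>" for y A and f :: "'a \<Rightarrow>\<^sub>L real"
  proof -
    have fin: "finite A" using A finite_subset by blast
    have card: "0 < real (card A)" "real (card A) \<le> real n"
      using A fin card_mono[OF _ A(2)] by (auto simp: card_gt_0_iff)
    define \<alpha> :: "nat \<Rightarrow> real" where "\<alpha> i = (if i \<in> A then 1 / real (card A) else 0)" for i
    have \<alpha>_sum: "(\<Sum>i=1..n. \<alpha> i) = 1"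
      using card A(2) unfolding \<alpha>_def by (simp add: sum.inter_restrict[symmetric] Int_absorb1)
    have "real (card A) * (1 - \<nu>) < (\<Sum>i\<in>A. blinfun_apply f (y i))"
      using sum_strict_mono[OF fin A(1), of "\<lambda>_. 1 - \<nu>"] fA by simp
    also have "\<dots> = blinfun_apply f (\<Sum>i\<in>A. y i)"
      by (simp add: blinfun.sum_right)
    also have "\<dots> \<le> norm (\<Sum>i\<in>A. y i)"
      using blinfun_apply_le_norm[of f "\<Sum>i\<in>A. y i"] f by simp
    finally have "1 - \<nu> < norm (\<Sum>i\<in>A. y i) / real (card A)"
      using card by (simp add: pos_less_divide_eq mult.commute)
    moreover have "(\<Sum>i=1..n. \<alpha> i *\<^sub>R y i) = (1 / real (card A)) *\<^sub>R (\<Sum>i\<in>A. y i)"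
      unfolding scaleR_sum_right
      by (rule sum.mono_neutral_cong_right) (use A(2) in \<open>auto simp: \<alpha>_def\<close>)
    ultimately have "1 - \<nu> < norm (\<Sum>i=1..n. \<alpha> i *\<^sub>R y i)"
      by simp
    moreover have \<alpha>_pos: "\<forall>i. 0 \<le> \<alpha> i" unfolding \<alpha>_def by simp
    ultimately obtain C where C: "C \<subseteq> {1..n}" "(\<Sum>i\<in>C. \<alpha> i) > 1 - \<epsilon> / real n"
      "hyperplane_approx n (\<epsilon> / real n) y C"
      using assms(4) y \<alpha>_sum unfolding AHSp_convex_const_def by blast
    have "A \<subseteq> C"
    proof (rule ccontr)
      assume "\<not> A \<subseteq> C"
      then obtain a where a: "a \<in> A" "a \<notin> C" by blast
      \<comment> \<open>Missing even one \<open>a\<close> of \<open>A\<close> costs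
        \<open>1 / card A\<close>, which is at least \<open>1 / n\<close> and so exceeds the
        permitted loss.\<close>
      have "(\<Sum>i\<in>C. \<alpha> i) \<le> (\<Sum>i\<in>{1..n} - {a}. \<alpha> i)"
        using C(1) a(2) \<alpha>_pos by (intro sum_mono2) auto
      also have "\<dots> = 1 - 1 / real (card A)"
        using \<alpha>_sum a A(2) by (subst sum_diff1) (auto simp: \<alpha>_def)
      also have "\<dots> \<le> 1 - 1 / real n"
        using card by (simp add: frac_le)
      also have "\<dots> \<le> 1 - \<epsilon> / real n"
        using assms(1,3) by (simp add: divide_right_mono)
      finally show False using C(2) by simp
    qed
    then show ?thesis
      by (rule hyperplane_approx_mono[OF C(3) _ C(1) le])
  qed
  moreover have "0 < \<nu>" "\<nu> < \<epsilon>"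
    using assms(4) le unfolding AHSp_convex_const_def by auto
  ultimately show ?thesis
    unfolding AHSp_const_def by (simp add: Ball_def) blast
qed

section \<open>Restriction of functionals and index sets, and the equivalence\<close>

lemma AHSp_const_subset:
  assumes "AHSp_const D n \<epsilon> \<gamma>" "B \<subseteq> D"
  shows "AHSp_const B n \<epsilon> \<gamma>"
  using assms unfolding AHSp_const_def by blast

lemma AHSp_initial_const_of_const:
  assumes "AHSp_const B n \<epsilon> \<gamma>"
  shows "AHSp_initial_const B n \<epsilon> \<gamma>"
  unfolding AHSp_initial_const_def
proof (intro conjI ballI allI impI)
  show "0 < \<gamma>" "\<gamma> < \<epsilon>" using assms unfolding AHSp_const_def by auto
  fix y n\<^sub>0 f
  assume "y \<in> M_tuples n"
    and "0 < n\<^sub>0 \<and> n\<^sub>0 \<le> n \<and> f \<in> B \<and> (\<forall>i\<in>{1..n\<^sub>0}. blinfun_apply f (y i) > 1 - \<gamma>)"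
  moreover from this have "{1..n\<^sub>0} \<noteq> {}" "{1..n\<^sub>0} \<subseteq> {1..n}" by auto
  ultimately show "hyperplane_approx n \<epsilon> y {1..n\<^sub>0}"
    using assms unfolding AHSp_const_def by blast
qed

theorem proposition2p9:
  fixes B :: "('a::banach \<Rightarrow>\<^sub>L real) set" and n :: nat
  assumes "0 < n" and "B \<subseteq> sphere 0 1" and "one_norming B"
  shows "(AHSp_linf TYPE('a) n \<longleftrightarrow> (\<forall>\<epsilon>\<in>{0<..<1}. \<exists>\<gamma>. AHSp_const B n \<epsilon> \<gamma>)) \<and>
    (AHSp_linf TYPE('a) n \<longleftrightarrow> (\<forall>\<epsilon>\<in>{0<..<1}. \<exists>\<rho>. AHSp_initial_const B n \<epsilon> \<rho>)) \<and>
    (AHSp_linf TYPE('a) n \<longleftrightarrow> (\<forall>\<epsilon>\<in>{0<..<1}. \<exists>\<nu>. AHSp_convex_const TYPE('a) n \<epsilon> \<nu>)) \<and>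
    (\<forall>\<gamma>. AHSp_linf_with TYPE('a) n \<gamma> \<longrightarrow>
      (\<forall>\<epsilon>\<in>{0<..<1}. AHSp_convex_const TYPE('a) n \<epsilon> ((\<gamma> \<epsilon>)\<^sup>2))) \<and>
    (\<forall>\<nu>. (\<forall>\<epsilon>\<in>{0<..<1}. AHSp_convex_const TYPE('a) n \<epsilon> (\<nu> \<epsilon>)) \<longrightarrow>
      AHSp_linf_with TYPE('a) n (\<lambda>\<epsilon>. \<nu> (\<epsilon> / real n))) \<and>
    (\<forall>\<rho>. (\<forall>\<epsilon>\<in>{0<..<1}. AHSp_initial_const B n \<epsilon> (\<rho> \<epsilon>)) \<longrightarrow>
      AHSp_linf_with TYPE('a) n (\<lambda>\<epsilon>. 1 / 4 * (\<rho> (\<epsilon> / real n))\<^sup>2))"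
proof -
  have scaled: "\<epsilon> / real n \<in> {0<..<1}" if "\<epsilon> \<in> {0<..<1}" for \<epsilon> :: real
    using that assms(1) by (auto simp: divide_less_eq)
  have m1: "AHSp_convex_const TYPE('a) n \<epsilon> ((\<gamma> \<epsilon>)\<^sup>2)"
    if "AHSp_linf_with TYPE('a) n \<gamma>" "\<epsilon> \<in> {0<..<1}" for \<gamma> \<epsilon>
    using AHSp_convex_const_of_const[OF assms(2,3)] that unfolding AHSp_linf_with_def by auto
  have m2: "AHSp_linf_with TYPE('a) n (\<lambda>\<epsilon>. \<nu> (\<epsilon> / real n))"
    if "\<forall>\<epsilon>\<in>{0<..<1}. AHSp_convex_const TYPE('a) n \<epsilon> (\<nu> \<epsilon>)" for \<nu>
    unfolding AHSp_linf_with_def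
  proof
    fix \<epsilon> :: real assume \<epsilon>: "\<epsilon> \<in> {0<..<1}"
    then show "AHSp_const (sphere (0 :: 'a \<Rightarrow>\<^sub>L real) 1) n \<epsilon> (\<nu> (\<epsilon> / real n))"
      using AHSp_const_of_convex_const[OF assms(1), where 'a = 'a] that scaled[OF \<epsilon>] by simp
  qed
  have m3: "AHSp_linf_with TYPE('a) n (\<lambda>\<epsilon>. 1 / 4 * (\<rho> (\<epsilon> / real n))\<^sup>2)"
    if "\<forall>\<epsilon>\<in>{0<..<1}. AHSp_initial_const B n \<epsilon> (\<rho> \<epsilon>)" for \<rho>
    unfolding AHSp_linf_with_def
  proof
    fix \<epsilon> :: real assume \<epsilon>: "\<epsilon> \<in> {0<..<1}"
    then show "AHSp_const (sphere (0 :: 'a \<Rightarrow>\<^sub>L real) 1) n \<epsilon> (1 / 4 * (\<rho> (\<epsilon> / real n))\<^sup>2)"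
      using AHSp_const_of_initial_const[OF assms(1,3)] that scaled[OF \<epsilon>] by simp
  qed
  have i12: "\<forall>\<epsilon>\<in>{0<..<1}. \<exists>\<gamma>. AHSp_const B n \<epsilon> \<gamma>" if "AHSp_linf TYPE('a) n"
    using that AHSp_const_subset[OF _ assms(2)] unfolding AHSp_linf_def AHSp_linf_with_def by blast
  have i23: "\<forall>\<epsilon>\<in>{0<..<1}. \<exists>\<rho>. AHSp_initial_const B n \<epsilon> \<rho>"
    if "\<forall>\<epsilon>\<in>{0<..<1}. \<exists>\<gamma>. AHSp_const B n \<epsilon> \<gamma>"
    using that AHSp_initial_const_of_const by blast
  \<comment> \<open>Choice collects the constants for the single \<open>\<epsilon>\<close> into one
    function, to which the quantitative statement applies.\<close>
  have i31: "AHSp_linf TYPE('a) n"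
    if "\<forall>\<epsilon>\<in>{0<..<1}. \<exists>\<rho>. AHSp_initial_const B n \<epsilon> \<rho>"
    using bchoice[OF that] m3 unfolding AHSp_linf_def by blast
  have i14: "\<forall>\<epsilon>\<in>{0<..<1}. \<exists>\<nu>. AHSp_convex_const TYPE('a) n \<epsilon> \<nu>" if "AHSp_linf TYPE('a) n"
    using that m1 unfolding AHSp_linf_def by blast
  have i41: "AHSp_linf TYPE('a) n"
    if "\<forall>\<epsilon>\<in>{0<..<1}. \<exists>\<nu>. AHSp_convex_const TYPE('a) n \<epsilon> \<nu>"
    using bchoice[OF that] m2 unfolding AHSp_linf_def by blast
  \<comment> \<open>The equivalences come from the cycles 1-2-3-1 and 1-4-1.\<close>
  show ?thesis
    using m1 m2 m3 i12 i23 i31 i14 i41 by blast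
qed

end
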